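(* Let $(\mathcal{A},\mathcal{T})$ be an ALF instance with $\mathcal{A} = (\mathcal{C}, \mathcal{H}, (\mathcal{S},\sqsubseteq_\mathrm{s},\sqcup,\bot_\mathrm{s}), \gamma, \kappa)$ where $\mathcal{S}$ is a complete sample lattice and $\mathcal{T}$ is realizable. Let $\lambda$ be a consistent learner and $\tau$ a teacher for $(\mathcal{A},\mathcal{T})$. Then there exists an ordinal $\alpha$ such that $\gamma(\lambda(S_{\tau,\lambda}^\alpha)) \in \mathcal{T}$.
   Context: An abstract learning framework (ALF) is a tuple $\mathcal{A} = (\mathcal{C}, \mathcal{H}, (\mathcal{S},\sqsubseteq_\mathrm{s},\sqcup,\bot_\mathrm{s}), \gamma, \kappa)$ where $\mathcal{C}$ (concept space) and $\mathcal{H}$ (hypothesis space) are classes, $(\mathcal{S},\sqsubseteq_\mathrm{s},\sqcup,\bot_\mathrm{s})$ (sample space) is a join semi-lattice with least element $\bot_\mathrm{s}$, $\gamma:\mathcal{H}\to\mathcal{C}$, and $\kappa:\mathcal{S}\to 2^{\mathcal{C}}$ satisfies $\kappa(\bot_\mathrm{s})=\mathcal{C}$ and $\kappa(S_1\sqcup S_2)=\kappa(S_1)\cap\kappa(S_2)$. The sample space is complete if every subset $\mathcal{S}'\subseteq\mathcal{S}$ has a join $\bigsqcup\mathcal{S}'$, and then $\kappa(\bigsqcup\mathcal{S}')=\bigcap_{S\in\mathcal{S}'}\kappa(S)$ is required. Let $\kappa_\mathcal{H}(S)=\{H\in\mathcal{H}\mid\gamma(H)\in\kappa(S)\}$; $S$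 is realizable if $\kappa_\mathcal{H}(S)\neq\emptyset$. An ALF instance is $(\mathcal{A},\mathcal{T})$ with $\mathcal{T}\subseteq\mathcal{C}$; $\mathcal{T}$ is realizable if $\gamma(H)\in\mathcal{T}$ for some $H\in\mathcal{H}$. A learner is a map $\lambda:\mathcal{S}\to\mathcal{H}$, consistent if $\gamma(\lambda(S))\in\kappa(S)$ for all realizable $S$. A teacher is a map $\tau:\mathcal{H}\to\mathcal{S}$ with (progress) $\tau(H)=\bot_\mathrm{s}$ if $\gamma(H)\in\mathcal{T}$ and $\gamma(H)\notin\kappa(\tau(H))$ if $\gamma(H)\notin\mathcal{T}$, and (honesty) $\mathcal{T}\subseteq\kappa(\tau(H))$ for all $H$. The transfinite sample sequence is $S_{\tau,\lambda}^0=\bot_\mathrm{s}$, $S_{\tau,\lambda}^{\alpha+1}=S_{\tau,\lambda}^\alpha\sqcup\tau(\lambda(S_{\tau,\lambda}^\alpha))$, and $S_{\tau,\lambda}^\alpha=\bigsqcup_{\beta<\alpha}S_{\tau,\lambda}^\beta$ for limit ordinals $\alpha$. *)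

theory Defs
  imports Main "HOL.BNF_Wellorder_Constructions"
begin

text \<open>
  Concept, hypothesis and sample spaces are types \<open>'c\<close>, \<open>'h\<close>, \<open>'s\<close>. A join semi-lattice with least
  element in which every subset has a join is a complete lattice, so complete sample spaces are
  rendered by the class \<open>complete_lattice\<close>. The map \<open>\<gamma>\<close> is part of the tuple but subject to no axiom.
\<close>

definition alf :: "('h \<Rightarrow> 'c) \<Rightarrow> ('s::bounded_semilattice_sup_bot \<Rightarrow> 'c set) \<Rightarrow> bool"
  where "alf \<gamma> \<kappa> \<longleftrightarrow> \<kappa> bot = UNIV \<and> (\<forall>S1 S2. \<kappa> (sup S1 S2) = \<kappa> S1 \<inter> \<kappa> S2)"

definition complete_alf :: "('h \<Rightarrow> 'c) \<Rightarrow> ('s::complete_lattice \<Rightarrow> 'c set) \<Rightarrow> bool"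
  where "complete_alf \<gamma> \<kappa> \<longleftrightarrow> alf \<gamma> \<kappa> \<and> (\<forall>X. \<kappa> (Sup X) = (\<Inter>S\<in>X. \<kappa> S))"

definition consistent_hyps :: "('h \<Rightarrow> 'c) \<Rightarrow> ('s \<Rightarrow> 'c set) \<Rightarrow> 's \<Rightarrow> 'h set"
  where "consistent_hyps \<gamma> \<kappa> S = {H. \<gamma> H \<in> \<kappa> S}"

definition realizable_sample :: "('h \<Rightarrow> 'c) \<Rightarrow> ('s \<Rightarrow> 'c set) \<Rightarrow> 's \<Rightarrow> bool"
  where "realizable_sample \<gamma> \<kappa> S \<longleftrightarrow> consistent_hyps \<gamma> \<kappa> S \<noteq> {}"

definition realizable_target :: "('h \<Rightarrow> 'c) \<Rightarrow> 'c set \<Rightarrow> bool"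
  where "realizable_target \<gamma> T \<longleftrightarrow> (\<exists>H. \<gamma> H \<in> T)"

definition consistent_learner :: "('h \<Rightarrow> 'c) \<Rightarrow> ('s \<Rightarrow> 'c set) \<Rightarrow> ('s \<Rightarrow> 'h) \<Rightarrow> bool"
  where "consistent_learner \<gamma> \<kappa> L \<longleftrightarrow> (\<forall>S. realizable_sample \<gamma> \<kappa> S \<longrightarrow> \<gamma> (L S) \<in> \<kappa> S)"

definition progress ::
    "('h \<Rightarrow> 'c) \<Rightarrow> ('s::bounded_semilattice_sup_bot \<Rightarrow> 'c set) \<Rightarrow> 'c set \<Rightarrow> ('h \<Rightarrow> 's) \<Rightarrow> bool"
  where "progress \<gamma> \<kappa> T \<tau> \<longleftrightarrow>
    (\<forall>H. (\<gamma> H \<in> T \<longrightarrow> \<tau> H = bot) \<and> (\<gamma> H \<notin> T \<longrightarrow> \<gamma> H \<notin> \<kappa> (\<tau> H)))"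

definition honesty :: "('s \<Rightarrow> 'c set) \<Rightarrow> 'c set \<Rightarrow> ('h \<Rightarrow> 's) \<Rightarrow> bool"
  where "honesty \<kappa> T \<tau> \<longleftrightarrow> (\<forall>H. T \<subseteq> \<kappa> (\<tau> H))"

definition teacher ::
    "('h \<Rightarrow> 'c) \<Rightarrow> ('s::bounded_semilattice_sup_bot \<Rightarrow> 'c set) \<Rightarrow> 'c set \<Rightarrow> ('h \<Rightarrow> 's) \<Rightarrow> bool"
  where "teacher \<gamma> \<kappa> T \<tau> \<longleftrightarrow> progress \<gamma> \<kappa> T \<tau> \<and> honesty \<kappa> T \<tau>"

text \<open>
  HOL has no type of all ordinals. The type \<open>'a ordinal\<close> consists of the order types of all
  well-orders on subsets of \<open>'a\<close>, that is, of the ordinals of cardinality at most that of \<open>'a\<close>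
  (an initial segment of the ordinals, of length the Hartogs number of \<open>'a\<close>). The relation
  \<open>ordIso\<close> is an equivalence on the relations satisfying \<open>Well_order\<close> only, whence the
  partial quotient.
\<close>

quotient_type 'a ordinal = "'a rel" / partial: "\<lambda>r s. (r, s) \<in> ordIso"
proof (rule part_equivpI)
  have "({}, {}) \<in> (ordIso :: ('a rel \<times> 'a rel) set)"
    by (rule ordIso_reflexive) simp
  then show "\<exists>r :: 'a rel. (r, r) \<in> ordIso" by blast
  show "symp (\<lambda>r s :: 'a rel. (r, s) \<in> ordIso)"
    by (auto intro: sympI ordIso_symmetric)
  show "transp (\<lambda>r s :: 'a rel. (r, s) \<in> ordIso)"
    by (auto intro: transpI ordIso_transitive)
qed

lemma Well_order_if_ordIso_self: "(r, r) \<in> ordIso \<Longrightarrow> Well_order r"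
  by (simp add: ordIso_def)

instantiation ordinal :: (type) wellorder
begin

lift_definition less_eq_ordinal :: "'a ordinal \<Rightarrow> 'a ordinal \<Rightarrow> bool"
  is "\<lambda>r s. (r, s) \<in> ordLeq"
  by (meson ordIso_ordLeq_trans ordIso_symmetric ordLeq_ordIso_trans)

lift_definition less_ordinal :: "'a ordinal \<Rightarrow> 'a ordinal \<Rightarrow> bool"
  is "\<lambda>r s. (r, s) \<in> ordLess"
  by (meson ordIso_ordLess_trans ordIso_symmetric ordLess_ordIso_trans)

instance
proof
  fix x y z :: "'a ordinal"
  show "x < y \<longleftrightarrow> x \<le> y \<and> \<not> y \<le> x"
    by transfer (meson Well_order_if_ordIso_self not_ordLeq_iff_ordLess ordLess_imp_ordLeq)
  show "x \<le> x" by transfer (rule ordIso_imp_ordLeq)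
  show "x \<le> y \<Longrightarrow> y \<le> z \<Longrightarrow> x \<le> z" by transfer (rule ordLeq_transitive)
  show "x \<le> y \<Longrightarrow> y \<le> x \<Longrightarrow> x = y" by transfer (simp add: ordIso_iff_ordLeq)
  show "x \<le> y \<or> y \<le> x"
    by transfer (meson ordLeq_total Well_order_if_ordIso_self)
next
  fix P :: "'a ordinal \<Rightarrow> bool" and a
  assume step: "\<And>x. (\<And>y. y < x \<Longrightarrow> P y) \<Longrightarrow> P x"
  define R :: "('a ordinal \<times> 'a ordinal) set" where "R = {(x, y). x < y}"
  have "R \<subseteq> inv_image ordLess rep_ordinal"
    by (auto simp: R_def less_ordinal_def)
  then have "wf R"
    using wf_subset wf_inv_image wf_ordLess by blast
  then show "P a"
    by (induction a rule: wf_induct_rule) (use step in \<open>auto simp: R_def\<close>)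
qed

end

definition is_zero :: "'o::wellorder \<Rightarrow> bool"
  where "is_zero \<alpha> \<longleftrightarrow> (\<forall>\<beta>. \<alpha> \<le> \<beta>)"

definition is_succ :: "'o::wellorder \<Rightarrow> 'o \<Rightarrow> bool"
  where "is_succ \<alpha> \<beta> \<longleftrightarrow> \<alpha> < \<beta> \<and> (\<forall>\<delta>. \<alpha> < \<delta> \<longrightarrow> \<beta> \<le> \<delta>)"

definition is_limit :: "'o::wellorder \<Rightarrow> bool"
  where "is_limit \<alpha> \<longleftrightarrow> \<not> is_zero \<alpha> \<and> (\<nexists>\<beta>. is_succ \<beta> \<alpha>)"

lemma is_succ_the: "is_succ \<beta> \<alpha> \<Longrightarrow> (THE \<beta>. is_succ \<beta> \<alpha>) = \<beta>"
  unfolding is_succ_def by (rule the_equality) (auto, metis leD linorder_cases)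

function sample_seq ::
    "('h \<Rightarrow> 's::complete_lattice) \<Rightarrow> ('s \<Rightarrow> 'h) \<Rightarrow> 'o::wellorder \<Rightarrow> 's"
  where "sample_seq \<tau> L \<alpha> =
    (if is_zero \<alpha> then bot
     else if \<exists>\<beta>. is_succ \<beta> \<alpha> then
       sup (sample_seq \<tau> L (THE \<beta>. is_succ \<beta> \<alpha>))
           (\<tau> (L (sample_seq \<tau> L (THE \<beta>. is_succ \<beta> \<alpha>))))
     else Sup (sample_seq \<tau> L ` {\<beta>. \<beta> < \<alpha>}))"
  by auto
termination
proof (relation "inv_image {(x, y). x < y} (\<lambda>(_, _, \<alpha>). \<alpha>)", goal_cases)
  case 1
  show ?case by (simp add: wf wf_inv_image)
next
  case 2
  then show ?case by (auto simp: is_succ_the) (simp add: is_succ_def)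
next
  case 3
  then show ?case by (auto simp: is_succ_the) (simp add: is_succ_def)
next
  case 4
  then show ?case by simp
qed

declare sample_seq.simps [simp del]

lemma sample_seq_zero: "is_zero \<alpha> \<Longrightarrow> sample_seq \<tau> L \<alpha> = bot"
  by (subst sample_seq.simps) simp

lemma sample_seq_succ:
  assumes "is_succ \<alpha> \<beta>"
  shows "sample_seq \<tau> L \<beta> = sup (sample_seq \<tau> L \<alpha>) (\<tau> (L (sample_seq \<tau> L \<alpha>)))"
proof -
  have "\<not> is_zero \<beta>" using assms by (auto simp: is_zero_def is_succ_def not_le)
  then show ?thesis using assms is_succ_the[OF assms] by (subst sample_seq.simps) auto
qed

lemma sample_seq_limit: "is_limit \<alpha> \<Longrightarrow> sample_seq \<tau> L \<alpha> = (SUP \<beta>\<in>{\<beta>. \<beta> < \<alpha>}. sample_seq \<tau> L \<beta>)"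
  by (subst sample_seq.simps) (auto simp: is_limit_def)

end

theory Submission
  imports Defs
begin

text \<open>
  As long as the target is not met, honesty keeps every sample realizable, and by progress the
  sample at stage \<open>\<alpha> + 1\<close> excludes the concept of a hypothesis that is consistent with the sample
  at stage \<open>\<alpha>\<close>. If the target were never met, the sample sequence would thus be injective. But an
  injection \<open>f\<close> of \<open>'a ordinal\<close> into \<open>'a\<close> is contradictory (Burali-Forti): it carries the
  order of \<open>'a ordinal\<close> to a well-order on \<open>range f\<close>, whose order type \<open>\<rho>\<close> would bound strictly
  the order types of all its proper initial segments, in particular of the one below \<open>f \<rho>\<close>,
  which is at least \<open>\<rho>\<close>.
\<close>

text \<open>At a least \<open>x\<close> with \<open>g x < x\<close>, the point \<open>g x\<close>
  would be a smaller counterexample, since strict monotonicity gives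
  \<open>g (g x) < g x\<close>.\<close>

lemma le_if_strict_mono:
  fixes g :: "'o::wellorder \<Rightarrow> 'o"
  assumes "strict_mono g"
  shows "x \<le> g x"
proof (induction x rule: less_induct)
  case (less x)
  show ?case
  proof (rule ccontr)
    assume "\<not> x \<le> g x"
    then have "g x < x" by simp
    then have "g x \<le> g (g x)" "g (g x) < g x"
      using less assms by (auto simp: strict_mono_def)
    then show False by simp
  qed
qed

lemma less_abs_ordinal_iff:
  assumes "Well_order r" "Well_order s"
  shows "abs_ordinal r < abs_ordinal s \<longleftrightarrow> (r, s) \<in> ordLess"
  using assms by (simp add: less_ordinal.abs_eq ordIso_reflexive)

lemma not_inj_ordinal:
  fixes f :: "'a ordinal \<Rightarrow> 'a"
  shows "\<not> inj f"
proof
  assume inj: "inj f"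
  have "Linear_order {(x, y :: 'a ordinal). x \<le> y}"
    by (auto simp: order_on_defs Field_def intro!: refl_onI transI antisymI total_onI)
  moreover have "{(x, y). x \<le> y} - Id = {(x, y :: 'a ordinal). x < y}"
    by auto
  ultimately have "Well_order {(x, y :: 'a ordinal). x \<le> y}"
    by (simp add: well_order_on_def wf)
  moreover define R where "R = dir_image {(x, y). x \<le> y} f"
  ultimately have R: "Well_order R"
    using inj by (simp add: Well_order_dir_image inj_on_def)
  have R_eq: "R = {(f a, f b) | a b. a \<le> b}"
    by (auto simp: R_def dir_image_def)
  define seg where "seg x = Restr R (underS R (f x))" for x
  have "underS R (f x) = f ` {..<x}" for x
    using inj by (auto simp: underS_def R_eq inj_eq less_le)
  then have seg_eq: "seg x = {(f a, f b) | a b. a \<le> b \<and> b < x}" for x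
    using inj by (fastforce simp: seg_def R_eq inj_eq)
  have seg: "Well_order (seg x)" for x
    unfolding seg_def by (rule Well_order_Restr[OF R])
  \<comment> \<open>Since \<open>seg x\<close> is a relation on \<open>'a\<close>, its order type
    lies again in \<open>'a ordinal\<close>; the map is a self-map, as
    \<open>le_if_strict_mono\<close> requires.\<close>
  have "strict_mono (\<lambda>x. abs_ordinal (seg x))"
  proof (rule strict_monoI)
    fix x y :: "'a ordinal"
    assume xy: "x < y"
    have "underS (seg y) (f x) = f ` {..<x}"
      using xy inj by (auto simp: underS_def seg_eq inj_eq less_le)
    \<comment> \<open>Cutting \<open>R\<close> at \<open>f x\<close> is the same as cutting
      \<open>seg y\<close> there, so \<open>seg x\<close> is a proper initial segment of
      \<open>seg y\<close>.\<close>
    then have "seg x = Restr (seg y) (underS (seg y) (f x))"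
      using xy inj by (fastforce simp: seg_eq inj_eq)
    moreover have "(f x, f x) \<in> seg y"
      using xy by (auto simp: seg_eq)
    then have "Field (seg y) \<noteq> {}"
      by (auto simp: Field_def)
    ultimately have "(seg x, seg y) \<in> ordLess"
      using underS_Restr_ordLess[OF seg] by metis
    then show "abs_ordinal (seg x) < abs_ordinal (seg y)"
      by (simp add: less_abs_ordinal_iff seg)
  qed
  then have "abs_ordinal R \<le> abs_ordinal (seg (abs_ordinal R))"
    by (rule le_if_strict_mono)
  moreover have "(seg x, R) \<in> ordLess" for x
    unfolding seg_def by (rule underS_Restr_ordLess[OF R]) (auto simp: R_eq Field_def)
  ultimately show False
    by (simp add: less_abs_ordinal_iff R seg flip: not_less)
qed

text \<open>The strict upper bound \<open>\<beta>\<close> is assumed because a greatest element of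
  the type has no successor.\<close>

lemma is_succ_exists:
  fixes \<alpha> \<beta> :: "'o::wellorder"
  assumes "\<alpha> < \<beta>"
  obtains \<delta> where "is_succ \<alpha> \<delta>" "\<delta> \<le> \<beta>"
proof
  show "is_succ \<alpha> (LEAST \<delta>. \<alpha> < \<delta>)"
    using assms by (auto simp: is_succ_def intro: LeastI Least_le)
  show "(LEAST \<delta>. \<alpha> < \<delta>) \<le> \<beta>"
    using assms by (rule Least_le)
qed

lemma zero_succ_limit_cases:
  obtains "is_zero \<alpha>" | \<beta> where "is_succ \<beta> \<alpha>" | "is_limit \<alpha>"
  by (auto simp: is_limit_def)

text \<open>Keeping the teacher's answer on the left lets one induction on \<open>\<beta>\<close>
  show both that samples grow and that no answer is lost.\<close>

lemma sample_seq_step_le: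
  fixes \<alpha> \<beta> :: "'o::wellorder"
  assumes "\<alpha> < \<beta>"
  shows "sup (sample_seq \<tau> L \<alpha>) (\<tau> (L (sample_seq \<tau> L \<alpha>))) \<le> sample_seq \<tau> L \<beta>"
  using assms
proof (induction \<beta> rule: less_induct)
  case (less \<beta>)
  show ?case
  proof (cases \<beta> rule: zero_succ_limit_cases)
    case 1
    with less.prems show ?thesis by (simp add: is_zero_def leD)
  next
    case (2 \<delta>)
    with less.prems have "\<alpha> = \<delta> \<or> \<alpha> < \<delta>" "\<delta> < \<beta>"
      unfolding is_succ_def by (metis leD linorder_neqE)+
    then show ?thesis
      using less.IH[of \<delta>] by (auto simp: sample_seq_succ[OF 2] intro: le_supI1)
  next
    case 3
    obtain \<delta> where \<delta>: "is_succ \<alpha> \<delta>" "\<delta> \<le> \<beta>"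
      using less.prems by (rule is_succ_exists)
    \<comment> \<open>A limit is no successor, so stage \<open>\<delta>\<close> is among those
      joined at \<open>\<beta>\<close>.\<close>
    with 3 have "\<delta> < \<beta>" by (auto simp: is_limit_def order_less_le)
    then show ?thesis
      unfolding sample_seq_limit[OF 3] sample_seq_succ[OF \<delta>(1), symmetric]
      by (intro SUP_upper) simp
  qed
qed

text \<open>Each stage joins honest answers, and \<open>\<kappa>\<close> turns joins into
  intersections.\<close>

lemma target_subset_sample_seq:
  fixes \<alpha> :: "'o::wellorder"
  assumes "complete_alf \<gamma> \<kappa>" "honesty \<kappa> T \<tau>"
  shows "T \<subseteq> \<kappa> (sample_seq \<tau> L \<alpha>)"
proof (induction \<alpha> rule: less_induct)
  case (less \<alpha>)
  show ?case
  proof (cases \<alpha> rule: zero_succ_limit_cases)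
    case 1
    then show ?thesis using assms(1)
      by (simp add: sample_seq_zero complete_alf_def alf_def)
  next
    case (2 \<beta>)
    then have "\<beta> < \<alpha>" by (simp add: is_succ_def)
    then show ?thesis using assms less
      by (auto simp: sample_seq_succ[OF 2] complete_alf_def alf_def honesty_def)
  next
    case 3
    then show ?thesis using assms(1) less
      by (auto simp: sample_seq_limit complete_alf_def)
  qed
qed

theorem theorem1:
  fixes \<gamma> :: "'h \<Rightarrow> 'c"
    and \<kappa> :: "'s::complete_lattice \<Rightarrow> 'c set"
    and T :: "'c set"
    and L :: "'s \<Rightarrow> 'h"
    and \<tau> :: "'h \<Rightarrow> 's"
  assumes "complete_alf \<gamma> \<kappa>"
    and "realizable_target \<gamma> T"
    and "consistent_learner \<gamma> \<kappa> L"
    and "teacher \<gamma> \<kappa> T \<tau>"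
  shows "\<exists>\<alpha> :: 's ordinal. \<gamma> (L (sample_seq \<tau> L \<alpha>)) \<in> T"
proof (rule ccontr)
  let ?S = "sample_seq \<tau> L :: 's ordinal \<Rightarrow> 's"
  assume "\<nexists>\<alpha> :: 's ordinal. \<gamma> (L (?S \<alpha>)) \<in> T"
  then have excluded: "\<gamma> (L (?S \<alpha>)) \<notin> \<kappa> (\<tau> (L (?S \<alpha>)))" for \<alpha>
    using assms(4) by (auto simp: teacher_def progress_def)
  have "T \<subseteq> \<kappa> (?S \<alpha>)" for \<alpha>
    using assms(1,4) by (intro target_subset_sample_seq) (auto simp: teacher_def)
  \<comment> \<open>A hypothesis that realizes \<open>T\<close> witnesses that every
    \<open>?S \<alpha>\<close> is realizable.\<close>
  then have consistent: "\<gamma> (L (?S \<alpha>)) \<in> \<kappa> (?S \<alpha>)" for \<alpha>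
    using assms(2,3)
    by (fastforce simp: consistent_learner_def realizable_sample_def realizable_target_def
        consistent_hyps_def)
  have "?S \<alpha> \<noteq> ?S \<beta>" if "\<alpha> < \<beta>" for \<alpha> \<beta>
  proof
    assume "?S \<alpha> = ?S \<beta>"
    with sample_seq_step_le[OF that, of \<tau> L]
    have "sup (?S \<alpha>) (\<tau> (L (?S \<alpha>))) = ?S \<alpha>"
      by (simp add: sup.absorb1)
    \<comment> \<open>An absorbed answer rules out no concept that the sample still allows.\<close>
    then have "\<kappa> (?S \<alpha>) \<subseteq> \<kappa> (\<tau> (L (?S \<alpha>)))"
      using assms(1) unfolding complete_alf_def alf_def by (metis Int_lower2)
    then show False
      using excluded consistent by blast
  qed
  then have "inj ?S"
    by (metis injI linorder_neqE)
  then show False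
    using not_inj_ordinal by blast
qed

end
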